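(* Let $\mathbf{w}$ be a generalized snake word of length $n>0$, let $\mathbf{s}$ be a regular snake word of length $n$ (i.e. $\varepsilon LRLR\cdots$ or $\varepsilon RLRL\cdots$), and let $\mathbf{l}$ be a ladder word of length $n$ (i.e. $\varepsilon LLLL\cdots$ or $\varepsilon RRRR\cdots$). Then for all $k\ge0$, $$[t^k]\,h^*(\mathbf{s};t)\le[t^k]\,h^*(\mathbf{w};t)\le[t^k]\,h^*(\mathbf{l};t).$$
   Context: Generalized snake words: for $n\ge 0$, a generalized snake word of length $n$ is $\mathbf{w}=w_0w_1\cdots w_n$ where $w_0=\varepsilon$ is the empty letter and $w_i\in\{L,R\}$ for $1\le i\le n$. Generalized snake posets: $P(\mathbf{w})$ is defined recursively. $P(\varepsilon)$ is the poset on $\{0,1,2,3\}$ with cover relations $1\prec 0$, $2\prec 0$, $3\prec 1$, $3\prec 2$. For $n\ge 1$, $P(w_0w_1\cdots w_n)$ is $P(w_0\cdots w_{n-1})\cup\{2n+2,2n+3\}$ with the added cover relations $2n+3\prec 2n+1$, $2n+3\prec 2n+2$, and: $2n+2\prec 2n-1$ if ($n=1$ and $w_1=L$) or ($n\ge2$ and $w_{n-1}w_n\in\{RL,LR\}$); $2n+2\prec 2n$ if ($n=1$ and $w_1=R$) or ($n\ge 2$ and $w_{n-1}w_n\in\{LL,RR\}$). Order polytope: for a finite poset $P$, $\mathcal{O}(P)=\{x\in[0,1]^P: x_i\le x_j \text{ whenever } i<_P j\}\subset\mathbb{R}^P$, a lattice polytope of dimension $|P|$. $h^*$-polynomial: $h^*(\mathbf{w};z)$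 is the polynomial defined by $\sum_{m\ge0}|m\,\mathcal{O}(P(\mathbf{w}))\cap\mathbb{Z}^{P(\mathbf{w})}|\,z^m=\dfrac{h^*(\mathbf{w};z)}{(1-z)^{d+1}}$ with $d=|P(\mathbf{w})|=2n+4$. $[t^k]f$ denotes the coefficient of $t^k$ in $f$. *)

theory Defs
  imports "HOL-Computational_Algebra.Polynomial_FPS" "HOL-Library.FuncSet"
begin

section \<open>Generalized snake words\<close>

text \<open>
  A generalized snake word \<open>w\<^sub>0 w\<^sub>1 \<dots> w\<^sub>n\<close> is represented by the list \<open>[w\<^sub>1, \<dots>, w\<^sub>n]\<close>: the empty
  letter \<open>w\<^sub>0\<close> carries no information and is dropped. Hence the length \<open>n\<close> of the word is the
  length of the list, and \<open>w\<^sub>i\<close> is \<open>w ! (i - 1)\<close> for \<open>1 \<le> i \<le> n\<close>.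
\<close>

datatype letter = L | R

type_synonym snake_word = "letter list"

definition regular_snake_words :: "nat \<Rightarrow> snake_word set" where
  "regular_snake_words n =
     {map (\<lambda>i. if even i then L else R) [0..<n], map (\<lambda>i. if even i then R else L) [0..<n]}"

definition ladder_words :: "nat \<Rightarrow> snake_word set" where
  "ladder_words n = {replicate n L, replicate n R}"

section \<open>Generalized snake posets\<close>

definition word_letter :: "snake_word \<Rightarrow> nat \<Rightarrow> letter" where
  "word_letter w i = w ! (i - 1)"

text \<open>
  \<open>snake_covers w n\<close> is the set of cover relations of \<open>P(w\<^sub>0 \<dots> w\<^sub>n)\<close>, for \<open>n \<le> length w\<close>; a pair
  \<open>(i, j)\<close> stands for \<open>i \<prec> j\<close>.
\<close>

fun snake_covers :: "snake_word \<Rightarrow> nat \<Rightarrow> (nat \<times> nat) set" where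
  "snake_covers w 0 = {(1, 0), (2, 0), (3, 1), (3, 2)}"
| "snake_covers w (Suc m) =
    (let n = Suc m in
       snake_covers w m
       \<union> {(2 * n + 3, 2 * n + 1), (2 * n + 3, 2 * n + 2)}
       \<union> (if (n = 1 \<and> word_letter w 1 = L)
             \<or> (n \<ge> 2 \<and> (word_letter w (n - 1), word_letter w n) \<in> {(R, L), (L, R)})
           then {(2 * n + 2, 2 * n - 1)} else {})
       \<union> (if (n = 1 \<and> word_letter w 1 = R)
             \<or> (n \<ge> 2 \<and> (word_letter w (n - 1), word_letter w n) \<in> {(L, L), (R, R)})
           then {(2 * n + 2, 2 * n)} else {}))"

definition snake_carrier :: "snake_word \<Rightarrow> nat set" where
  "snake_carrier w = {0..2 * length w + 3}"

text \<open>The strict order \<open><\<^sub>P\<close> of \<open>P(w)\<close>.\<close>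

definition snake_less :: "snake_word \<Rightarrow> (nat \<times> nat) set" where
  "snake_less w = (snake_covers w (length w))\<^sup>+"

lemma snake_covers_bounds: "(i, j) \<in> snake_covers w n \<Longrightarrow> j < i \<and> i \<le> 2 * n + 3"
proof (induction n)
  case 0
  then show ?case by auto
next
  case (Suc m)
  have "(i, j) \<in> snake_covers w m \<union> {(2 * Suc m + 3, 2 * Suc m + 1), (2 * Suc m + 3, 2 * Suc m + 2)}
      \<union> {(2 * Suc m + 2, 2 * Suc m - 1)} \<union> {(2 * Suc m + 2, 2 * Suc m)}"
    using Suc.prems unfolding snake_covers.simps Let_def
    by (rule rev_subsetD) (intro Un_mono order_refl, simp_all only: subset_refl empty_subsetI split: if_split, blast+)
  then show ?case using Suc.IH by auto
qed

lemma snake_less_bounds: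
  assumes "(i, j) \<in> snake_less w"
  shows "j < i \<and> i \<le> 2 * length w + 3"
  using assms unfolding snake_less_def
proof (induction rule: trancl_induct)
  case (base y)
  then show ?case by (rule snake_covers_bounds)
next
  case (step y z)
  then show ?case using snake_covers_bounds[OF step.hyps(2)] by simp
qed

lemma snake_less_strict_order:
  "snake_less w \<subseteq> snake_carrier w \<times> snake_carrier w"
  "irrefl (snake_less w)"
  "trans (snake_less w)"
proof -
  show "snake_less w \<subseteq> snake_carrier w \<times> snake_carrier w"
    using snake_less_bounds by (fastforce simp: snake_carrier_def)
  show "irrefl (snake_less w)"
    using snake_less_bounds by (fastforce simp: irrefl_def)
  show "trans (snake_less w)"
    by (simp add: snake_less_def)
qed

lemma card_snake_carrier: "card (snake_carrier w) = 2 * length w + 4"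
  by (simp add: snake_carrier_def)

section \<open>Order polytopes and their \<open>h\<^sup>*\<close>-polynomials\<close>

text \<open>
  For a finite set \<open>P\<close>, the space \<open>\<real>\<^sup>P\<close> is the set of functions \<open>P \<rightarrow>\<^sub>E UNIV\<close>, which take the
  value \<open>undefined\<close> outside \<open>P\<close>; so a point is determined by its coordinates in \<open>P\<close> and
  cardinalities of sets of points are as expected.
\<close>

definition order_polytope :: "'a set \<Rightarrow> ('a \<times> 'a) set \<Rightarrow> ('a \<Rightarrow> real) set" where
  "order_polytope P r = {x \<in> P \<rightarrow>\<^sub>E {0..1}. \<forall>i\<in>P. \<forall>j\<in>P. (i, j) \<in> r \<longrightarrow> x i \<le> x j}"

definition dilate :: "'a set \<Rightarrow> nat \<Rightarrow> ('a \<Rightarrow> real) set \<Rightarrow> ('a \<Rightarrow> real) set" where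
  "dilate P m S = (\<lambda>x. \<lambda>i\<in>P. real m * x i) ` S"

definition lattice_point_count :: "'a set \<Rightarrow> ('a \<Rightarrow> real) set \<Rightarrow> nat" where
  "lattice_point_count P S = card (S \<inter> (P \<rightarrow>\<^sub>E \<int>))"

definition ehrhart_series :: "'a set \<Rightarrow> ('a \<Rightarrow> real) set \<Rightarrow> real fps" where
  "ehrhart_series P S = Abs_fps (\<lambda>m. real (lattice_point_count P (dilate P m S)))"

text \<open>
  \<open>h_star P S\<close> is the \<open>h\<^sup>*\<close>-polynomial of a full-dimensional lattice polytope \<open>S\<close> in \<open>\<real>\<^sup>P\<close>, so
  \<open>d = card P\<close>. The coefficients are taken in the reals so that the defining quotient can be
  formed in the ring of formal power series.
\<close>

definition h_star :: "'a set \<Rightarrow> ('a \<Rightarrow> real) set \<Rightarrow> real poly" where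
  "h_star P S =
     (THE h. ehrhart_series P S = fps_of_poly h / (1 - fps_X) ^ (card P + 1))"

lemma h_star_eqI:
  assumes "ehrhart_series P S = fps_of_poly h / (1 - fps_X) ^ (card P + 1)"
  shows "h_star P S = h"
  unfolding h_star_def
proof (rule the_equality)
  show "ehrhart_series P S = fps_of_poly h / (1 - fps_X) ^ (card P + 1)" by fact
next
  fix h' :: "real poly"
  let ?q = "(1 - fps_X :: real fps) ^ (card P + 1)"
  assume "ehrhart_series P S = fps_of_poly h' / ?q"
  with assms have eq: "fps_of_poly h' / ?q = fps_of_poly h / ?q" by simp
  have nz: "fps_nth ?q 0 \<noteq> 0" by (simp add: fps_power_zeroth)
  then have inv: "inverse ?q * ?q = 1" by (rule inverse_mult_eq_1)
  from eq have "fps_of_poly h' * inverse ?q = fps_of_poly h * inverse ?q"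
    by (simp only: fps_divide_unit[OF nz])
  then have "fps_of_poly h' * (inverse ?q * ?q) = fps_of_poly h * (inverse ?q * ?q)"
    by (simp only: mult.assoc[symmetric])
  then have "fps_of_poly h' = fps_of_poly h"
    by (simp only: inv mult_1_right)
  then show "h' = h" by (simp only: fps_of_poly_eq_iff)
qed

definition snake_h_star :: "snake_word \<Rightarrow> real poly" where
  "snake_h_star w = h_star (snake_carrier w) (order_polytope (snake_carrier w) (snake_less w))"

end

theory Submission
  imports Defs "HOL-Combinatorics.Transposition"
begin

text \<open>
  A word is determined by its first letter and its turns, the positions \<open>k \<ge> 2\<close> at which the
  letter changes. A turn affects a single cover relation: the element \<open>2k+2\<close> lies below \<open>2k-1\<close>
  at a turn and below \<open>2k\<close> otherwise; the first letter makes this choice for \<open>k = 1\<close>. A regular snake turns at all positions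
  \<open>k \<ge> 2\<close> and a ladder at none, so it suffices that straightening one turn does not decrease any
  coefficient (\<open>ascent_count_straighten\<close>), and that the choice at \<open>k = 1\<close> can be changed freely.

  Every cover relation goes from a larger to a smaller number, so Stanley's theory of
  \<open>P\<close>-partitions, with the labels in reverse order, gives
  \<open>h\<^sup>* = \<Sum> t^asc(\<sigma>)\<close>, the sum over the linear extensions \<open>\<sigma>\<close> of the poset, bottom element first
  (\<open>h_star_order_polytope\<close>).

  On linear extensions, straightening is an injection that preserves ascents. Let \<open>a = 2k-1\<close>,
  \<open>b = 2k\<close> and \<open>c = 2k+2\<close>. A linear extension of the poset with \<open>c \<prec> a\<close> that violates \<open>c \<prec> b\<close>
  has the form \<open>\<dots> b \<dots> c \<dots> a \<dots>\<close>; exchange \<open>a\<close> and \<open>b\<close> in it. The result satisfies \<open>c \<prec> b\<close> and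
  violates \<open>c \<prec> a\<close>, and the remaining relations survive because, apart from \<open>c\<close>, the elements
  below \<open>a\<close> are also below \<open>b\<close> and the elements above \<open>b\<close> are also above \<open>a\<close>. As \<open>a\<close> and \<open>b\<close> are
  consecutive numbers that are kept apart by \<open>c\<close>, no comparison between neighbouring entries
  changes (\<open>card_linear_extensions_move_cover\<close>).
\<close>

section \<open>Linear extensions and their ascents\<close>

definition before :: "'a list \<Rightarrow> 'a \<Rightarrow> 'a \<Rightarrow> bool" where
  "before xs x y \<longleftrightarrow> (\<exists>i j. i < j \<and> j < length xs \<and> xs ! i = x \<and> xs ! j = y)"

lemma before_total:
  assumes "x \<in> set xs" "y \<in> set xs" "x \<noteq> y"
  shows "before xs x y \<or> before xs y x"
  using assms unfolding before_def in_set_conv_nth by (metis nat_neq_iff)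

lemma before_trans:
  assumes "distinct xs" "before xs x y" "before xs y z"
  shows "before xs x z"
proof -
  obtain i j where ij: "i < j" "j < length xs" "xs ! i = x" "xs ! j = y"
    using assms(2) by (auto simp: before_def)
  obtain k l where kl: "k < l" "l < length xs" "xs ! k = y" "xs ! l = z"
    using assms(3) by (auto simp: before_def)
  have "j = k" using assms(1) ij kl by (simp add: nth_eq_iff_index_eq[symmetric])
  then show ?thesis using ij kl unfolding before_def by (metis less_trans)
qed

lemma before_irrefl:
  assumes "distinct xs"
  shows "\<not> before xs x x"
  using assms by (auto simp: before_def nth_eq_iff_index_eq)

lemma before_map:
  assumes "before xs x y"
  shows "before (map f xs) (f x) (f y)"
  using assms unfolding before_def by (metis length_map less_trans nth_map)

lemma before_sorted_wrt:
  assumes "sorted_wrt P xs" "before xs x y"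
  shows "P x y"
  using assms by (auto simp: before_def sorted_wrt_iff_nth_less)

definition linear_extensions :: "nat \<Rightarrow> (nat \<times> nat) set \<Rightarrow> nat list set" where
  "linear_extensions N r =
     {xs. distinct xs \<and> set xs = {..<N} \<and> (\<forall>(i, j) \<in> r. before xs i j)}"

definition ascents :: "nat list \<Rightarrow> nat set" where
  "ascents xs = {k. Suc k < length xs \<and> xs ! k < xs ! Suc k}"

lemma finite_linear_extensions: "finite (linear_extensions N r)"
proof (rule finite_subset)
  show "linear_extensions N r \<subseteq> {xs. set xs \<subseteq> {..<N} \<and> length xs = N}"
    by (auto simp: linear_extensions_def dest: distinct_card)
  show "finite {xs. set xs \<subseteq> {..<N} \<and> length xs = N}"
    by (rule finite_lists_length_eq) simp
qed

text \<open>The recursion that matches the one for \<open>sorted_maps\<close> below.\<close>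

lemma card_ascents_snoc:
  "card (ascents (xs @ [x])) = card (ascents xs) + (if xs \<noteq> [] \<and> last xs < x then 1 else 0)"
proof -
  have fin: "finite (ascents xs)" by (rule finite_subset[of _ "{..<length xs}"]) (auto simp: ascents_def)
  have notin: "length xs - 1 \<notin> ascents xs" by (auto simp: ascents_def)
  have "k \<in> ascents (xs @ [x]) \<longleftrightarrow>
      k \<in> ascents xs \<or> xs \<noteq> [] \<and> last xs < x \<and> k = length xs - 1" for k
  proof -
    consider "Suc k < length xs" | "Suc k = length xs" | "length xs < Suc k" by linarith
    then show ?thesis
    proof cases
      case 2
      then have "xs \<noteq> []" "k = length xs - 1" by auto
      then show ?thesis using 2 by (simp add: ascents_def nth_append last_conv_nth)
    next
      case 1
      then have "k \<noteq> length xs - 1" by linarith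
      then show ?thesis using 1 by (simp add: ascents_def nth_append)
    next
      case 3
      then have "xs \<noteq> [] \<Longrightarrow> k \<noteq> length xs - 1" by (cases xs) auto
      then show ?thesis using 3 by (auto simp: ascents_def)
    qed
  qed
  then have "ascents (xs @ [x]) =
      (if xs \<noteq> [] \<and> last xs < x then insert (length xs - 1) (ascents xs) else ascents xs)"
    unfolding set_eq_iff by (simp del: One_nat_def) blast
  then show ?thesis using fin notin by simp
qed

section \<open>Counting the order-preserving maps sorted by a given list\<close>

text \<open>
  Ties between values are broken by putting the larger number first. The cover relations go from
  larger to smaller numbers, so a map respects a pair \<open>(i, j)\<close> of the order iff \<open>i\<close> precedes \<open>j\<close>
  in this strict total order.
\<close>

definition precedes :: "(nat \<Rightarrow> nat) \<Rightarrow> nat \<Rightarrow> nat \<Rightarrow> bool" where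
  "precedes f x y \<longleftrightarrow> f x < f y \<or> f x = f y \<and> y < x"

definition sorted_maps :: "nat list \<Rightarrow> nat \<Rightarrow> (nat \<Rightarrow> nat) set" where
  "sorted_maps xs m = {f \<in> set xs \<rightarrow>\<^sub>E {..m}. sorted_wrt (precedes f) xs}"

lemma finite_sorted_maps: "finite (sorted_maps xs m)"
  by (rule finite_subset[of _ "set xs \<rightarrow>\<^sub>E {..m}"]) (auto simp: sorted_maps_def intro!: finite_PiE)

lemma precedes_trans: "precedes f x y \<Longrightarrow> precedes f y z \<Longrightarrow> precedes f x z"
  by (auto simp: precedes_def)

lemma sorted_wrt_snoc_iff:
  "sorted_wrt (precedes f) (xs @ [x]) \<longleftrightarrow>
     sorted_wrt (precedes f) xs \<and> (xs \<noteq> [] \<longrightarrow> precedes f (last xs) x)"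
proof (cases xs rule: rev_cases)
  case (snoc ys y)
  then show ?thesis by (auto simp: sorted_wrt_append intro: precedes_trans)
qed simp

text \<open>
  The last entry carries the largest value \<open>v\<close>. If it ends an ascent, then the tie-breaking rule
  forces the previous entry, and with it all others, to have a value strictly below \<open>v\<close>.
\<close>

lemma sorted_maps_snoc:
  assumes "x \<notin> set xs"
  shows "sorted_maps (xs @ [x]) m =
    (\<Union>v\<in>{..m}. (\<lambda>f. f(x := v)) `
       (if xs \<noteq> [] \<and> last xs < x then (if v = 0 then {} else sorted_maps xs (v - 1))
        else sorted_maps xs v))" (is "_ = (\<Union>v\<in>_. _ ` ?A v)")
proof (intro equalityI subsetI)
  fix g assume g: "g \<in> sorted_maps (xs @ [x]) m"
  define f where "f = g(x := undefined)"
  have gf: "g = f(x := g x)" by (simp add: f_def)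
  have s: "sorted_wrt (precedes g) xs" "xs \<noteq> [] \<Longrightarrow> precedes g (last xs) x"
    using g by (auto simp: sorted_maps_def sorted_wrt_snoc_iff)
  have s': "sorted_wrt (precedes f) xs"
    using s(1) by (rule sorted_wrt_mono_rel[rotated]) (use assms in \<open>auto simp: f_def precedes_def\<close>)
  have le: "g y \<le> g (last xs)" if "y \<in> set xs" for y
  proof -
    have "y = last xs \<or> y \<in> set (butlast xs)"
      using that by (cases xs rule: rev_cases) auto
    moreover have "precedes g y (last xs)" if "y \<in> set (butlast xs)"
      using s(1) that by (cases xs rule: rev_cases) (auto simp: sorted_wrt_append)
    ultimately show ?thesis by (auto simp: precedes_def)
  qed
  have fx: "f \<in> set xs \<rightarrow>\<^sub>E UNIV"
    using g assms by (auto simp: sorted_maps_def f_def PiE_def extensional_def)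
  have "f \<in> ?A (g x)"
  proof (cases "xs \<noteq> [] \<and> last xs < x")
    case True
    then have lt: "g (last xs) < g x" using s(2) by (auto simp: precedes_def)
    have "f y \<le> g x - 1" if "y \<in> set xs" for y
      using le[OF that] lt that assms by (auto simp: f_def)
    then show ?thesis using True lt s' fx by (auto simp: sorted_maps_def PiE_def)
  next
    case False
    have "f y \<le> g x" if "y \<in> set xs" for y
    proof -
      have "g (last xs) \<le> g x" using s(2) that by (force simp: precedes_def)
      then show ?thesis using le[OF that] that assms by (auto simp: f_def)
    qed
    then show ?thesis using False s' fx by (auto simp: sorted_maps_def PiE_def)
  qed
  moreover have "g x \<le> m" using g by (auto simp: sorted_maps_def)
  ultimately show "g \<in> (\<Union>v\<in>{..m}. (\<lambda>f. f(x := v)) ` ?A v)" using gf by blast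
next
  fix g assume "g \<in> (\<Union>v\<in>{..m}. (\<lambda>f. f(x := v)) ` ?A v)"
  then obtain v f where v: "v \<le> m" and f: "f \<in> ?A v" and g: "g = f(x := v)" by blast
  have s: "sorted_wrt (precedes f) xs" and ext: "f \<in> set xs \<rightarrow>\<^sub>E UNIV"
    using f by (auto simp: sorted_maps_def split: if_splits)
  have s': "sorted_wrt (precedes g) xs"
    using s by (rule sorted_wrt_mono_rel[rotated]) (use assms in \<open>auto simp: g precedes_def\<close>)
  have bound: "f y \<le> u" if "f \<in> sorted_maps xs u" "y \<in> set xs" for u y
    using that by (auto simp: sorted_maps_def)
  have le: "f y \<le> v" if "y \<in> set xs" for y
    using f bound[of v, OF _ that] bound[of "v - 1", OF _ that] by (auto split: if_splits)
  have lt: "f y < v" if "y \<in> set xs" "last xs < x" for y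
  proof -
    have "v \<noteq> 0" "f \<in> sorted_maps xs (v - 1)" using f that by (auto split: if_splits)
    then show ?thesis using bound[OF _ that(1)] by fastforce
  qed
  have "precedes g (last xs) x" if "xs \<noteq> []"
  proof -
    have "last xs \<in> set xs" using that by simp
    moreover from this have "last xs \<noteq> x" using assms by auto
    ultimately show ?thesis
      using le[of "last xs"] lt[of "last xs"] by (fastforce simp: g precedes_def)
  qed
  then have "sorted_wrt (precedes g) (xs @ [x])" using s' by (simp add: sorted_wrt_snoc_iff)
  moreover have "g \<in> set (xs @ [x]) \<rightarrow>\<^sub>E {..m}"
    using ext le v assms by (auto simp: g PiE_def extensional_def intro: order_trans)
  ultimately show "g \<in> sorted_maps (xs @ [x]) m" by (simp add: sorted_maps_def)
qed

lemma card_sorted_maps_snoc: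
  assumes "x \<notin> set xs"
  shows "card (sorted_maps (xs @ [x]) m) =
    (\<Sum>v\<le>m. if xs \<noteq> [] \<and> last xs < x then (if v = 0 then 0 else card (sorted_maps xs (v - 1)))
        else card (sorted_maps xs v))"
proof -
  define A where "A v = (if xs \<noteq> [] \<and> last xs < x
      then (if v = 0 then {} else sorted_maps xs (v - 1)) else sorted_maps xs v)" for v
  have und: "f x = undefined" if "f \<in> A v" for f v
    using that assms by (auto simp: A_def sorted_maps_def PiE_def extensional_def split: if_splits)
  have inj: "inj_on (\<lambda>f. f(x := v)) (A v)" for v
    by (rule inj_onI) (metis und fun_upd_triv fun_upd_upd)
  have "card (sorted_maps (xs @ [x]) m) = card (\<Union>v\<in>{..m}. (\<lambda>f. f(x := v)) ` A v)"
    unfolding A_def sorted_maps_snoc[OF assms] ..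
  also have "\<dots> = (\<Sum>v\<le>m. card ((\<lambda>f. f(x := v)) ` A v))"
  proof (rule card_UN_disjoint)
    show "\<forall>v\<in>{..m}. finite ((\<lambda>f. f(x := v)) ` A v)"
      by (auto simp: A_def finite_sorted_maps)
    show "\<forall>v\<in>{..m}. \<forall>w\<in>{..m}. v \<noteq> w \<longrightarrow>
        (\<lambda>f. f(x := v)) ` A v \<inter> (\<lambda>f. f(x := w)) ` A w = {}"
      by (auto dest: fun_upd_eqD)
  qed simp
  also have "\<dots> = (\<Sum>v\<le>m. card (A v))" using inj by (simp add: card_image)
  finally show ?thesis by (simp add: A_def if_distrib[of card] cong: if_cong)
qed

text \<open>
  Appending an entry sums the counts up to \<open>m\<close>, which divides the series by \<open>1 - X\<close>; an ascent
  also shifts the counts by one, which is a multiplication by \<open>X\<close>.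
\<close>

lemma sorted_maps_generating_function:
  assumes "distinct xs"
  shows "Abs_fps (\<lambda>m. real (card (sorted_maps xs m))) * (1 - fps_X) ^ (length xs + 1)
           = fps_X ^ card (ascents xs)"
  using assms
proof (induction xs rule: rev_induct)
  case Nil
  have "sorted_maps [] m = {\<lambda>_. undefined}" for m
    by (auto simp: sorted_maps_def)
  moreover have "Abs_fps (\<lambda>_. 1::real) * (1 - fps_X) = 1"
    by (rule fps_ext) (simp add: right_diff_distrib fps_X_mult_right_nth)
  ultimately show ?case by (simp add: ascents_def)
next
  case (snoc x xs)
  let ?asc = "xs \<noteq> [] \<and> last xs < x"
  let ?F = "\<lambda>ys. Abs_fps (\<lambda>m. real (card (sorted_maps ys m)))"
  have "?F (xs @ [x]) * (1 - fps_X) = (if ?asc then fps_X else 1) * ?F xs"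
  proof (rule fps_ext)
    fix m
    show "fps_nth (?F (xs @ [x]) * (1 - fps_X)) m = fps_nth ((if ?asc then fps_X else 1) * ?F xs) m"
      using snoc.prems
      by (cases m) (auto simp: right_diff_distrib fps_X_mult_right_nth fps_X_mult_nth card_sorted_maps_snoc)
  qed
  then have "?F (xs @ [x]) * (1 - fps_X) ^ (length (xs @ [x]) + 1)
      = (if ?asc then fps_X else 1) * (?F xs * (1 - fps_X) ^ (length xs + 1))"
    by (simp add: mult_ac)
  also have "\<dots> = fps_X ^ card (ascents (xs @ [x]))"
    using snoc by (simp add: card_ascents_snoc)
  finally show ?case .
qed

section \<open>The h-star polynomial as ascent generating function\<close>

text \<open>
  The total order \<open>precedes f\<close> on \<open>{..<N}\<close> is represented by one natural number per element, so
  that sorting by a key applies.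
\<close>

lemma ex_sorting_list:
  "\<exists>xs. distinct xs \<and> set xs = {..<N} \<and> sorted_wrt (precedes f) xs"
proof -
  define key where "key x = f x * Suc N + (N - x)" for x
  define xs where "xs = sort_key key [0..<N]"
  have key_le: "key x \<le> key y \<Longrightarrow> precedes f x y" if "x < N" "y < N" "x \<noteq> y" for x y
  proof (rule ccontr)
    assume le: "key x \<le> key y" and "\<not> precedes f x y"
    then have "f y < f x \<or> f x = f y \<and> x < y"
      using \<open>x \<noteq> y\<close> unfolding precedes_def by linarith
    then consider "f y < f x" | "f x = f y" "x < y" by blast
    then show False
    proof cases
      case 1
      then have "Suc (f y) * Suc N \<le> f x * Suc N" by (intro mult_le_mono1) simp
      then show False using le that by (simp add: key_def)
    next
      case 2
      then show False using le that by (simp add: key_def)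
    qed
  qed
  have d: "distinct xs" "set xs = {..<N}" by (auto simp: xs_def)
  have "sorted_wrt (\<lambda>x y. key x \<le> key y) xs"
    unfolding xs_def using sorted_sort_key[of key "[0..<N]"] by (simp add: sorted_map)
  then have "sorted_wrt (precedes f) xs"
    using d unfolding sorted_wrt_iff_nth_less
    by (metis key_le less_trans lessThan_iff nat_neq_iff nth_eq_iff_index_eq nth_mem)
  then show ?thesis using d by blast
qed

lemma sorting_list_unique:
  assumes "distinct xs" "distinct ys" "set xs = set ys"
    and "sorted_wrt (precedes f) xs" "sorted_wrt (precedes f) ys"
  shows "xs = ys"
  using assms
proof (induction xs arbitrary: ys)
  case (Cons x xs)
  then obtain y ys' where ys: "ys = y # ys'" by (cases ys) auto
  have "x = y"
  proof (rule ccontr)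
    assume "x \<noteq> y"
    then have "precedes f x y" "precedes f y x" using Cons.prems ys by auto
    then show False by (auto simp: precedes_def)
  qed
  then show ?case using Cons ys by (metis distinct.simps(2) insert_ident list.simps(15) sorted_wrt.simps(2))
qed simp

definition order_maps :: "nat \<Rightarrow> (nat \<times> nat) set \<Rightarrow> nat \<Rightarrow> (nat \<Rightarrow> nat) set" where
  "order_maps N r m = {f \<in> {..<N} \<rightarrow>\<^sub>E {..m}. \<forall>(i, j) \<in> r. f i \<le> f j}"

text \<open>
  Every map is sorted by exactly one permutation, and whether the map preserves the order can be
  read off from this permutation.
\<close>

lemma card_order_maps:
  assumes r: "\<And>i j. (i, j) \<in> r \<Longrightarrow> j < i \<and> i < N"
  shows "card (order_maps N r m) = (\<Sum>xs \<in> linear_extensions N r. card (sorted_maps xs m))"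
proof -
  have "order_maps N r m = (\<Union>xs \<in> linear_extensions N r. sorted_maps xs m)"
  proof (intro equalityI subsetI)
    fix f assume f: "f \<in> order_maps N r m"
    obtain xs where xs: "distinct xs" "set xs = {..<N}" "sorted_wrt (precedes f) xs"
      using ex_sorting_list by blast
    have "before xs i j" if "(i, j) \<in> r" for i j
    proof -
      have "precedes f i j" using f r[OF that] that by (force simp: order_maps_def precedes_def)
      then have "\<not> precedes f j i" by (auto simp: precedes_def)
      then show ?thesis
        using before_total[of i xs j] before_sorted_wrt[OF xs(3)] r[OF that] xs(2) by force
    qed
    then have "xs \<in> linear_extensions N r" using xs by (auto simp: linear_extensions_def)
    moreover have "f \<in> sorted_maps xs m" using f xs by (auto simp: order_maps_def sorted_maps_def)
    ultimately show "f \<in> (\<Union>xs \<in> linear_extensions N r. sorted_maps xs m)" by blast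
  next
    fix f assume "f \<in> (\<Union>xs \<in> linear_extensions N r. sorted_maps xs m)"
    then obtain xs where xs: "xs \<in> linear_extensions N r" and f: "f \<in> sorted_maps xs m" by blast
    have "f i \<le> f j" if "(i, j) \<in> r" for i j
    proof -
      have "before xs i j" using xs that by (auto simp: linear_extensions_def)
      then have "precedes f i j" using f by (auto simp: sorted_maps_def intro: before_sorted_wrt)
      then show ?thesis by (auto simp: precedes_def)
    qed
    then show "f \<in> order_maps N r m"
      using xs f by (auto simp: order_maps_def sorted_maps_def linear_extensions_def)
  qed
  moreover have "sorted_maps xs m \<inter> sorted_maps ys m = {}"
    if "xs \<in> linear_extensions N r" "ys \<in> linear_extensions N r" "xs \<noteq> ys" for xs ys
    using that sorting_list_unique[of xs ys] by (auto simp: sorted_maps_def linear_extensions_def)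
  ultimately show ?thesis
    by (simp add: card_UN_disjoint finite_linear_extensions finite_sorted_maps)
qed

lemma trancl_mono_map:
  fixes f :: "'a \<Rightarrow> 'b::preorder"
  assumes "(i, j) \<in> r\<^sup>+" and "\<And>i j. (i, j) \<in> r \<Longrightarrow> f i \<le> f j"
  shows "f i \<le> f j"
  using assms(1) by induction (auto intro: assms(2) order_trans)

lemma lattice_points_order_polytope:
  assumes r: "\<And>i j. (i, j) \<in> r \<Longrightarrow> j < i \<and> i < N"
  shows "lattice_point_count {..<N} (dilate {..<N} m (order_polytope {..<N} (r\<^sup>+)))
           = card (order_maps N r m)"
proof -
  let ?P = "{..<N}"
  let ?real = "\<lambda>f. \<lambda>i\<in>?P. real (f i)"
  have "dilate ?P m (order_polytope ?P (r\<^sup>+)) \<inter> (?P \<rightarrow>\<^sub>E \<int>) = ?real ` order_maps N r m"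
  proof (intro equalityI subsetI)
    fix y assume "y \<in> dilate ?P m (order_polytope ?P (r\<^sup>+)) \<inter> (?P \<rightarrow>\<^sub>E \<int>)"
    then obtain x where x: "x \<in> order_polytope ?P (r\<^sup>+)" and y: "y = (\<lambda>i\<in>?P. real m * x i)"
      and int: "y \<in> ?P \<rightarrow>\<^sub>E \<int>" by (auto simp: dilate_def)
    have x01: "0 \<le> x i" "x i \<le> 1" if "i < N" for i
      using x that by (auto simp: order_polytope_def PiE_def Pi_def)
    define f where "f = (\<lambda>i\<in>?P. nat \<lfloor>y i\<rfloor>)"
    have yf: "real (f i) = y i" if "i < N" for i
    proof -
      have "y i \<in> \<int>" using int that by auto
      moreover have "0 \<le> y i" using x01[OF that] that by (simp add: y)
      ultimately show ?thesis using that by (simp add: f_def)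
    qed
    have "f i \<le> m" if "i < N" for i
    proof -
      have "y i \<le> real m" using x01[OF that] that by (simp add: y mult_left_le)
      then show ?thesis using yf[OF that] by linarith
    qed
    moreover have "f i \<le> f j" if "(i, j) \<in> r" for i j
    proof -
      have ij: "i < N" "j < N" using r[OF that] by auto
      have "x i \<le> x j" using x that ij by (auto simp: order_polytope_def)
      then have "y i \<le> y j" using ij by (simp add: y mult_left_mono)
      then show ?thesis using yf[OF ij(1)] yf[OF ij(2)] by linarith
    qed
    moreover have "f \<in> {..<N} \<rightarrow>\<^sub>E UNIV" by (simp add: f_def)
    ultimately have "f \<in> order_maps N r m"
      unfolding order_maps_def PiE_def Pi_def by blast
    moreover have "y = ?real f"
      by (rule ext) (use yf int in \<open>auto simp: PiE_def extensional_def\<close>)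
    ultimately show "y \<in> ?real ` order_maps N r m" by blast
  next
    fix y assume "y \<in> ?real ` order_maps N r m"
    then obtain f where f: "f \<in> order_maps N r m" and y: "y = ?real f" by blast
    \<comment> \<open>For \<open>m = 0\<close> the quotient is \<open>0\<close> by convention, which is a point of the polytope.\<close>
    define x where "x = (\<lambda>i\<in>?P. real (f i) / real m)"
    have fm: "f i \<le> m" if "i < N" for i
      using f that by (auto simp: order_maps_def PiE_def Pi_def)
    have "x \<in> ?P \<rightarrow>\<^sub>E {0..1}" using fm by (auto simp: x_def divide_le_eq_1)
    moreover have "x i \<le> x j" if "(i, j) \<in> r\<^sup>+" "i < N" "j < N" for i j
    proof -
      have "f i \<le> f j"
        using that(1) by (rule trancl_mono_map) (use f in \<open>auto simp: order_maps_def\<close>)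
      then show ?thesis using that by (simp add: x_def divide_right_mono)
    qed
    ultimately have "x \<in> order_polytope ?P (r\<^sup>+)" by (auto simp: order_polytope_def)
    moreover have "y = (\<lambda>i\<in>?P. real m * x i)"
      by (rule ext) (use fm in \<open>force simp: y x_def\<close>)
    ultimately have "y \<in> dilate ?P m (order_polytope ?P (r\<^sup>+))" unfolding dilate_def by blast
    moreover have "y \<in> ?P \<rightarrow>\<^sub>E \<int>" by (auto simp: y)
    ultimately show "y \<in> dilate ?P m (order_polytope ?P (r\<^sup>+)) \<inter> (?P \<rightarrow>\<^sub>E \<int>)" by blast
  qed
  moreover have "inj_on ?real (order_maps N r m)"
  proof (rule inj_onI)
    fix f g assume fg: "f \<in> order_maps N r m" "g \<in> order_maps N r m" and eq: "?real f = ?real g"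
    have "f i = g i" if "i < N" for i using fun_cong[OF eq, of i] that by simp
    then show "f = g"
      using fg by (intro PiE_ext[of f ?P "\<lambda>_. {..m}"]) (auto simp: order_maps_def)
  qed
  ultimately show ?thesis by (simp add: lattice_point_count_def card_image)
qed

text \<open>
  Each linear extension contributes \<open>X ^ asc / (1 - X) ^ (N + 1)\<close> to the Ehrhart series.
\<close>

lemma h_star_order_polytope:
  assumes r: "\<And>i j. (i, j) \<in> r \<Longrightarrow> j < i \<and> i < N"
  shows "h_star {..<N} (order_polytope {..<N} (r\<^sup>+))
           = (\<Sum>xs \<in> linear_extensions N r. monom 1 (card (ascents xs)))"
proof (rule h_star_eqI)
  let ?P = "{..<N}" and ?E = "linear_extensions N r"
  let ?q = "(1 - fps_X :: real fps) ^ (card ?P + 1)"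
  let ?h = "\<Sum>xs \<in> ?E. monom 1 (card (ascents xs)) :: real poly"
  let ?S = "ehrhart_series ?P (order_polytope ?P (r\<^sup>+))"
  have "?S = (\<Sum>xs \<in> ?E. Abs_fps (\<lambda>m. real (card (sorted_maps xs m))))"
    by (rule fps_ext)
      (simp add: ehrhart_series_def lattice_points_order_polytope[OF r] card_order_maps[OF r] fps_sum_nth)
  then have "?S * ?q = (\<Sum>xs \<in> ?E. Abs_fps (\<lambda>m. real (card (sorted_maps xs m))) * ?q)"
    by (simp add: sum_distrib_right)
  also have "\<dots> = (\<Sum>xs \<in> ?E. fps_X ^ card (ascents xs))"
  proof (rule sum.cong)
    fix xs assume "xs \<in> ?E"
    then have "distinct xs" "length xs = card ?P"
      by (auto simp: linear_extensions_def dest: distinct_card)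
    then show "Abs_fps (\<lambda>m. real (card (sorted_maps xs m))) * ?q = fps_X ^ card (ascents xs)"
      using sorted_maps_generating_function[of xs] by simp
  qed simp
  also have "\<dots> = fps_of_poly ?h"
    by (simp add: fps_of_poly_sum fps_of_poly_monom)
  finally have eq: "?S * ?q = fps_of_poly ?h" .
  have nz: "fps_nth ?q 0 \<noteq> 0" by (simp add: fps_power_zeroth)
  have "?S = ?S * (?q * inverse ?q)" using inverse_mult_eq_1[OF nz] by (simp add: mult.commute)
  also have "\<dots> = fps_of_poly ?h / ?q" by (simp only: mult.assoc[symmetric] eq fps_divide_unit[OF nz])
  finally show "?S = fps_of_poly ?h / ?q" .
qed

lemma coeff_ascent_polynomial:
  assumes "finite E"
  shows "coeff (\<Sum>xs \<in> E. monom 1 (f xs) :: real poly) k = real (card {xs \<in> E. f xs = k})"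
proof -
  have "coeff (\<Sum>xs \<in> E. monom 1 (f xs) :: real poly) k = (\<Sum>xs \<in> E. if f xs = k then 1 else 0)"
    by (simp add: coeff_sum)
  also have "\<dots> = real (card {xs \<in> E. f xs = k})"
    using assms by (simp flip: sum.inter_filter)
  finally show ?thesis .
qed

section \<open>Exchanging two adjacent labels\<close>

text \<open>
  Exchanging two consecutive numbers changes no comparison except the one between themselves.
\<close>

lemma ascents_map_transpose:
  assumes ab: "a = Suc b \<or> b = Suc a"
    and apart: "\<And>k. Suc k < length xs \<Longrightarrow> {xs ! k, xs ! Suc k} \<noteq> {a, b}"
    and "distinct xs"
  shows "ascents (map (transpose a b) xs) = ascents xs"
proof -
  have "transpose a b (xs ! k) < transpose a b (xs ! Suc k) \<longleftrightarrow> xs ! k < xs ! Suc k"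
    if "Suc k < length xs" for k
    using apart[OF that] ab by (auto simp: transpose_def doubleton_eq_iff)
  then show ?thesis by (auto simp: ascents_def)
qed

lemma adjacent_between:
  assumes "distinct xs" "before xs x c" "before xs c y" "Suc k < length xs"
  shows "{xs ! k, xs ! Suc k} \<noteq> {x, y}"
proof
  assume "{xs ! k, xs ! Suc k} = {x, y}"
  then consider "xs ! k = x" "xs ! Suc k = y" | "xs ! k = y" "xs ! Suc k = x"
    by (auto simp: doubleton_eq_iff)
  moreover obtain i j where ij: "i < j" "j < length xs" "xs ! i = x" "xs ! j = c"
    using assms(2) by (auto simp: before_def)
  moreover obtain j' l where jl: "j' < l" "l < length xs" "xs ! j' = c" "xs ! l = y"
    using assms(3) by (auto simp: before_def)
  moreover have "j = j'" using assms(1) ij jl by (simp add: nth_eq_iff_index_eq[symmetric])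
  ultimately show False
    using assms(1,4) by cases (auto simp: nth_eq_iff_index_eq dest: Suc_lessD)
qed

text \<open>
  The injection fixes the common linear extensions and exchanges \<open>a\<close> and \<open>b\<close> in the others, where
  \<open>c\<close> stands between them. The two hypotheses \<open>up\<close> and \<open>down\<close> say that \<open>a\<close> is at least as
  constrained from above as \<open>b\<close>, and \<open>b\<close> at least as constrained from below as \<open>a\<close>; this is what
  lets \<open>a\<close> move towards the front of the list and \<open>b\<close> towards its end.
\<close>

lemma card_linear_extensions_move_cover:
  assumes ab: "a = Suc b \<or> b = Suc a" and c: "c \<noteq> a" "c \<noteq> b" "c < N"
    and ltN: "a < N" "b < N"
    and up: "\<And>j. (b, j) \<in> r \<Longrightarrow> (a, j) \<in> r"
    and down: "\<And>i. (i, a) \<in> r \<Longrightarrow> (i, b) \<in> r"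
    and incomp: "(a, b) \<notin> r" "(b, a) \<notin> r"
  shows "card {xs \<in> linear_extensions N (insert (c, a) r). card (ascents xs) = k}
       \<le> card {xs \<in> linear_extensions N (insert (c, b) r). card (ascents xs) = k}"
proof -
  let ?t = "transpose a b"
  let ?E = "\<lambda>x. linear_extensions N (insert (c, x) r)"
  have main: "map ?t xs \<in> ?E b - ?E a \<and> card (ascents (map ?t xs)) = card (ascents xs)"
    if xs: "xs \<in> ?E a - ?E b" for xs
  proof -
    have d: "distinct xs" "set xs = {..<N}" and ca: "before xs c a"
      and R: "\<And>i j. (i, j) \<in> r \<Longrightarrow> before xs i j"
      using xs by (auto simp: linear_extensions_def)
    have "\<not> before xs c b" using xs by (auto simp: linear_extensions_def)
    then have bc: "before xs b c" using before_total[of b xs c] c ltN d by auto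
    have ba: "before xs b a" using before_trans[OF d(1) bc ca] .
    have tr: "before (map ?t xs) x y" if "before xs (?t x) (?t y)" for x y
      using before_map[OF that, of ?t] by simp
    have tcb: "before (map ?t xs) c b" by (rule tr) (use ca c in simp)
    have tac: "before (map ?t xs) a c" by (rule tr) (use bc c in simp)
    have dt: "distinct (map ?t xs)" using d by (simp add: distinct_map)
    have st: "set (map ?t xs) = {..<N}"
    proof -
      have "?t ` {..<N} = {..<N}" using ltN by (intro transpose_image_eq) simp
      then show ?thesis using d by simp
    qed
    have "before (map ?t xs) i j" if ij: "(i, j) \<in> r" for i j
    proof (rule tr)
      have "before xs i j" using R ij .
      moreover have "(a, j) \<in> r" if "i = b" using up ij that by simp
      moreover have "(i, b) \<in> r" if "j = a" using down ij that by simp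
      ultimately have cases: "before xs i j" "i = b \<Longrightarrow> before xs a j" "j = a \<Longrightarrow> before xs i b"
        using R by auto
      consider "i = a" "j \<noteq> b" | "i = b" "j \<noteq> a" | "i \<noteq> a" "i \<noteq> b" "j = a"
        | "i \<noteq> a" "i \<noteq> b" "j = b" | "i \<noteq> a" "i \<noteq> b" "j \<noteq> a" "j \<noteq> b"
        using ij incomp by blast
      then show "before xs (?t i) (?t j)"
      proof cases
        case 1
        then have "j \<noteq> a" using cases(1) before_irrefl[OF d(1)] by auto
        moreover have "before xs b j" using before_trans[OF d(1) ba] cases(1) 1 by simp
        ultimately show ?thesis using 1 by simp
      next
        case 2
        then have "j \<noteq> b" using cases(1) before_irrefl[OF d(1)] by auto
        then show ?thesis using 2 cases(2) by simp
      next
        case 3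
        then show ?thesis using cases(3) by simp
      next
        case 4
        have "before xs i a" using before_trans[OF d(1) _ ba] cases(1) 4 by simp
        then show ?thesis using 4 by simp
      next
        case 5
        then show ?thesis using cases(1) by simp
      qed
    qed
    then have "map ?t xs \<in> ?E b" using dt st tcb by (auto simp: linear_extensions_def)
    moreover have "map ?t xs \<notin> ?E a"
      using before_trans[OF dt tac] before_irrefl[OF dt] by (auto simp: linear_extensions_def)
    moreover have "ascents (map ?t xs) = ascents xs"
      using ab adjacent_between[OF d(1) bc ca] d(1)
      by (intro ascents_map_transpose) (auto simp: insert_commute)
    ultimately show ?thesis by simp
  qed
  define \<phi> where "\<phi> xs = (if xs \<in> ?E b then xs else map ?t xs)" for xs
  have "inj_on \<phi> (?E a)"
  proof (rule inj_onI)
    fix xs ys assume "xs \<in> ?E a" "ys \<in> ?E a" "\<phi> xs = \<phi> ys"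
    moreover have "map ?t xs = map ?t ys \<Longrightarrow> xs = ys" by (simp add: inj_map_eq_map)
    ultimately show "xs = ys" using main by (force simp: \<phi>_def split: if_splits)
  qed
  then have "inj_on \<phi> {xs \<in> ?E a. card (ascents xs) = k}" by (rule inj_on_subset) blast
  moreover have "\<phi> ` {xs \<in> ?E a. card (ascents xs) = k} \<subseteq> {xs \<in> ?E b. card (ascents xs) = k}"
    using main by (auto simp: \<phi>_def)
  ultimately show ?thesis by (rule card_inj_on_le) (simp add: finite_linear_extensions)
qed

section \<open>Snake posets from their turns\<close>

text \<open>
  The first letter has no predecessor. \<open>L\<close> counts as a turn there because it hangs the element
  \<open>4\<close> below \<open>1\<close>, just as a turn at \<open>k\<close> hangs \<open>2k+2\<close> below \<open>2k-1\<close>.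
\<close>

definition turns :: "snake_word \<Rightarrow> nat \<Rightarrow> bool" where
  "turns w k \<longleftrightarrow> (if k = 1 then word_letter w 1 = L else word_letter w (k - 1) \<noteq> word_letter w k)"

text \<open>The cover relations that are common to all words of length \<open>n\<close>.\<close>

definition rung_covers :: "nat \<Rightarrow> (nat \<times> nat) set" where
  "rung_covers n = {(1, 0), (2, 0)}
     \<union> (\<Union>k\<in>{..n}. {(2 * k + 3, 2 * k + 1), (2 * k + 3, 2 * k + 2)})"

text \<open>The only cover relation that depends on whether the word turns at \<open>k\<close>.\<close>

definition hook :: "(nat \<Rightarrow> bool) \<Rightarrow> nat \<Rightarrow> nat \<times> nat" where
  "hook t k = (2 * k + 2, if t k then 2 * k - 1 else 2 * k)"

definition turn_covers :: "(nat \<Rightarrow> bool) \<Rightarrow> nat \<Rightarrow> (nat \<times> nat) set" where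
  "turn_covers t n = rung_covers n \<union> hook t ` {1..n}"

lemma snake_covers_eq: "snake_covers w n = turn_covers (turns w) n"
proof (induction n)
  case 0
  then show ?case by (auto simp: turn_covers_def rung_covers_def)
next
  case (Suc m)
  have letters: "x \<noteq> L \<longleftrightarrow> x = R" for x by (cases x) auto
  have "(if (Suc m = 1 \<and> word_letter w 1 = L)
             \<or> (Suc m \<ge> 2 \<and> (word_letter w (Suc m - 1), word_letter w (Suc m)) \<in> {(R, L), (L, R)})
           then {(2 * Suc m + 2, 2 * Suc m - 1)} else {})
       \<union> (if (Suc m = 1 \<and> word_letter w 1 = R)
             \<or> (Suc m \<ge> 2 \<and> (word_letter w (Suc m - 1), word_letter w (Suc m)) \<in> {(L, L), (R, R)})
           then {(2 * Suc m + 2, 2 * Suc m)} else {}) = {hook (turns w) (Suc m)}"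
    by (cases "word_letter w (Suc m - 1)"; cases "word_letter w (Suc m)")
      (auto simp: hook_def turns_def letters)
  moreover have "turn_covers (turns w) (Suc m) = turn_covers (turns w) m
     \<union> {(2 * Suc m + 3, 2 * Suc m + 1), (2 * Suc m + 3, 2 * Suc m + 2)} \<union> {hook (turns w) (Suc m)}"
    unfolding turn_covers_def rung_covers_def atMost_Suc
    using atLeastAtMostSuc_conv[of 1 m] by auto
  ultimately show ?case
    unfolding snake_covers.simps Let_def Suc.IH by (simp only: Un_assoc)
qed

definition ascent_count :: "(nat \<Rightarrow> bool) \<Rightarrow> nat \<Rightarrow> nat \<Rightarrow> nat" where
  "ascent_count t n k =
     card {xs \<in> linear_extensions (2 * n + 4) (turn_covers t n). card (ascents xs) = k}"

lemma coeff_snake_h_star: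
  "coeff (snake_h_star w) k = real (ascent_count (turns w) (length w) k)"
proof -
  have N: "snake_carrier w = {..<2 * length w + 4}" by (auto simp: snake_carrier_def)
  have "snake_h_star w = (\<Sum>xs \<in> linear_extensions (2 * length w + 4) (turn_covers (turns w) (length w)).
      monom 1 (card (ascents xs)))"
    unfolding snake_h_star_def N snake_less_def snake_covers_eq[symmetric]
    by (rule h_star_order_polytope) (use snake_covers_bounds in fastforce)
  then show ?thesis
    by (simp add: coeff_ascent_polynomial finite_linear_extensions ascent_count_def)
qed

lemma ascent_count_cong:
  assumes "\<And>k. 1 \<le> k \<Longrightarrow> k \<le> n \<Longrightarrow> t k = t' k"
  shows "ascent_count t n = ascent_count t' n"
proof -
  have "hook t ` {1..n} = hook t' ` {1..n}"
    by (rule image_cong) (use assms in \<open>simp_all add: hook_def\<close>)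
  then show ?thesis by (simp add: fun_eq_iff ascent_count_def turn_covers_def)
qed

definition covers_except :: "(nat \<Rightarrow> bool) \<Rightarrow> nat \<Rightarrow> nat \<Rightarrow> (nat \<times> nat) set" where
  "covers_except t n p = rung_covers n \<union> hook t ` ({1..n} - {p})"

lemma in_covers_except_iff:
  "(i, j) \<in> covers_except t n p \<longleftrightarrow> (i = 1 \<or> i = 2) \<and> j = 0
     \<or> (\<exists>q\<le>n. i = 2 * q + 3 \<and> (j = 2 * q + 1 \<or> j = 2 * q + 2))
     \<or> (\<exists>q\<in>{1..n} - {p}. i = 2 * q + 2 \<and> j = (if t q then 2 * q - 1 else 2 * q))"
proof -
  have "(i, j) \<in> rung_covers n \<longleftrightarrow> (i = 1 \<or> i = 2) \<and> j = 0
     \<or> (\<exists>q\<le>n. i = 2 * q + 3 \<and> (j = 2 * q + 1 \<or> j = 2 * q + 2))"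
    unfolding rung_covers_def Un_iff UN_iff insert_iff empty_iff prod.inject Bex_def atMost_iff by blast
  moreover have "(i, j) \<in> hook t ` ({1..n} - {p}) \<longleftrightarrow>
     (\<exists>q\<in>{1..n} - {p}. i = 2 * q + 2 \<and> j = (if t q then 2 * q - 1 else 2 * q))"
    unfolding hook_def image_iff prod.inject by (rule refl)
  ultimately show ?thesis unfolding covers_except_def by blast
qed

lemma turn_covers_split:
  assumes "1 \<le> p" "p \<le> n"
  shows "turn_covers t n = insert (hook t p) (covers_except t n p)"
  unfolding turn_covers_def covers_except_def using assms by auto

text \<open>
  The elements \<open>2p-1\<close> and \<open>2p\<close> are the two middle elements of a diamond with bottom \<open>2p+1\<close>. Only
  the relation chosen at \<open>p\<close> attaches a further element to one of them from below.
\<close>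

lemma covers_except_below:
  assumes "1 \<le> p" "p \<le> n" "x = 2 * p - 1 \<or> x = 2 * p"
  shows "(i, x) \<in> covers_except t n p \<longleftrightarrow> i = 2 * p + 1"
proof
  have x: "x + 1 = 2 * p \<or> x = 2 * p" using assms by auto
  assume "(i, x) \<in> covers_except t n p"
  then consider "x = 0" | q where "i = 2 * q + 3" "x = 2 * q + 1 \<or> x = 2 * q + 2"
    | q where "1 \<le> q" "q \<noteq> p" "x = (if t q then 2 * q - 1 else 2 * q)"
    unfolding in_covers_except_iff Bex_def Diff_iff atLeastAtMost_iff singleton_iff by blast
  then show "i = 2 * p + 1"
  proof cases
    case 1
    then show ?thesis using x assms(1) by auto
  next
    case 2
    have "p = q + 1" using x 2(2) by presburger
    then show ?thesis using 2(1) by simp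
  next
    case 3
    then have "x + 1 = 2 * q \<or> x = 2 * q" by (auto split: if_splits)
    then have "p = q" using x by presburger
    then show ?thesis using 3(2) by simp
  qed
next
  assume i: "i = 2 * p + 1"
  have "p - 1 \<le> n" using assms(2) by simp
  moreover have "i = 2 * (p - 1) + 3" "x = 2 * (p - 1) + 1 \<or> x = 2 * (p - 1) + 2"
    using i assms(1,3) by auto
  ultimately show "(i, x) \<in> covers_except t n p" unfolding in_covers_except_iff by blast
qed

lemma covers_except_first:
  assumes "i = 1 \<or> i = 2"
  shows "(i, j) \<in> covers_except t n p \<longleftrightarrow> j = 0"
proof -
  have "i \<noteq> 2 * q + 3" "1 \<le> q \<Longrightarrow> i \<noteq> 2 * q + 2" for q using assms by presburger+
  then show ?thesis using assms unfolding in_covers_except_iff by auto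
qed

text \<open>
  For \<open>p \<ge> 2\<close> the element \<open>2p-1\<close> is the bottom of the previous diamond and hence lies below both
  of its sides, whereas \<open>2p\<close> hangs below only one of them. For \<open>p = 1\<close> both lie below \<open>0\<close> only.
\<close>

lemma covers_except_above:
  assumes p: "1 \<le> p" "p \<le> n" and j: "(2 * p, j) \<in> covers_except t n p"
  shows "(2 * p - 1, j) \<in> covers_except t n p"
proof (cases "p = 1")
  case True
  then show ?thesis using j covers_except_first[of 1 j] covers_except_first[of 2 j] by simp
next
  case False
  then have "2 * p \<noteq> 1 \<and> 2 * p \<noteq> 2 \<and> 2 * p \<noteq> 2 * q + 3" for q using p(1) by presburger
  with j obtain q where "2 * p = 2 * q + 2" "j = (if t q then 2 * q - 1 else 2 * q)"
    unfolding in_covers_except_iff by blast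
  then have "j = 2 * (p - 2) + 1 \<or> j = 2 * (p - 2) + 2" using False p by (auto split: if_splits)
  moreover have "2 * p - 1 = 2 * (p - 2) + 3" "p - 2 \<le> n" using False p by presburger+
  ultimately show ?thesis unfolding in_covers_except_iff by blast
qed

text \<open>
  At \<open>p = 1\<close> the elements \<open>1\<close> and \<open>2\<close> have the same neighbours in the remaining relations, so the
  exchange also works from straight to turn.
\<close>

lemma ascent_count_straighten:
  assumes p: "1 \<le> p" "p \<le> n" and tp: "t p \<or> p = 1"
  shows "ascent_count t n k \<le> ascent_count (t(p := b)) n k"
proof (cases "b = t p")
  case True
  then show ?thesis by simp
next
  case False
  let ?r = "covers_except t n p"
  let ?top = "\<lambda>b. if b then 2 * p - 1 else 2 * p"
  have r: "covers_except (t(p := b)) n p = ?r"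
    unfolding covers_except_def
    by (rule arg_cong2[where f = "(\<union>)"] image_cong refl)+ (auto simp: hook_def)
  have "card {xs \<in> linear_extensions (2 * n + 4) (insert (2 * p + 2, ?top (t p)) ?r). card (ascents xs) = k}
     \<le> card {xs \<in> linear_extensions (2 * n + 4) (insert (2 * p + 2, ?top b) ?r). card (ascents xs) = k}"
  proof (rule card_linear_extensions_move_cover)
    show "?top (t p) = Suc (?top b) \<or> ?top b = Suc (?top (t p))" using False p by auto
    have below: "(i, ?top c) \<in> ?r \<longleftrightarrow> i = 2 * p + 1" for i c
      by (rule covers_except_below[OF p]) simp
    show "(?top b, j) \<in> ?r \<Longrightarrow> (?top (t p), j) \<in> ?r" for j
    proof (cases "p = 1")
      case True
      assume "(?top b, j) \<in> ?r"
      then show ?thesis using True covers_except_first[of _ j t n p] by (auto split: if_splits)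
    next
      case pn: False
      assume "(?top b, j) \<in> ?r"
      then show ?thesis using pn tp False covers_except_above[OF p] by simp
    qed
    show "(i, ?top (t p)) \<in> ?r \<Longrightarrow> (i, ?top b) \<in> ?r" for i unfolding below .
    show "(?top (t p), ?top b) \<notin> ?r" "(?top b, ?top (t p)) \<notin> ?r"
      unfolding below using p by auto
  qed (use p in auto)
  then show ?thesis
    by (simp add: ascent_count_def turn_covers_split[OF p] r hook_def)
qed

text \<open>
  The turns of \<open>t\<close> are replaced by those of \<open>t'\<close> one position at a time, starting from \<open>1\<close>.
\<close>

lemma ascent_count_mono:
  assumes "\<And>p. 2 \<le> p \<Longrightarrow> p \<le> n \<Longrightarrow> t' p \<Longrightarrow> t p"
  shows "ascent_count t n k \<le> ascent_count t' n k"
proof -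
  define s where "s j = (\<lambda>p. if p \<le> j then t' p else t p)" for j
  have "ascent_count t n k \<le> ascent_count (s j) n k" if "j \<le> n" for j
    using that
  proof (induction j)
    case 0
    have "ascent_count t n = ascent_count (s 0) n"
      by (rule ascent_count_cong) (simp add: s_def)
    then show ?case by simp
  next
    case (Suc j)
    have upd: "s (Suc j) = (s j)(Suc j := t' (Suc j))" by (auto simp: s_def fun_eq_iff le_Suc_eq)
    have "ascent_count (s j) n k \<le> ascent_count (s (Suc j)) n k"
    proof (cases "s j (Suc j) \<or> Suc j = 1")
      case True
      then show ?thesis unfolding upd using Suc.prems by (intro ascent_count_straighten) auto
    next
      case False
      then have "t' (Suc j) = s j (Suc j)" using assms[of "Suc j"] Suc.prems by (auto simp: s_def)
      then have "s (Suc j) = s j" unfolding upd by simp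
      then show ?thesis by simp
    qed
    then show ?case using Suc by simp
  qed
  from this[of n] have "ascent_count t n k \<le> ascent_count (s n) n k" by simp
  also have "ascent_count (s n) n = ascent_count t' n"
    by (rule ascent_count_cong) (simp add: s_def)
  finally show ?thesis .
qed

lemma regular_snake_turns:
  assumes "s \<in> regular_snake_words n" "2 \<le> p" "p \<le> n"
  shows "turns s p"
proof -
  obtain q where "p = Suc (Suc q)" using assms(2) by (metis add_2_eq_Suc le_Suc_ex)
  then show ?thesis using assms by (auto simp: regular_snake_words_def turns_def word_letter_def split: if_splits)
qed

lemma ladder_turns:
  assumes "l \<in> ladder_words n" "2 \<le> p" "p \<le> n"
  shows "\<not> turns l p"
  using assms by (auto simp: ladder_words_def turns_def word_letter_def)

theorem corollary4p20:
  fixes n :: nat and w s l :: snake_word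
  assumes "n > 0"
    and "length w = n"
    and "s \<in> regular_snake_words n"
    and "l \<in> ladder_words n"
  shows "\<forall>k. coeff (snake_h_star s) k \<le> coeff (snake_h_star w) k
           \<and> coeff (snake_h_star w) k \<le> coeff (snake_h_star l) k"
proof -
  have "length s = n" "length l = n"
    using assms by (auto simp: regular_snake_words_def ladder_words_def)
  moreover have "ascent_count (turns s) n k \<le> ascent_count (turns w) n k" for k
    by (rule ascent_count_mono) (rule regular_snake_turns[OF assms(3)])
  moreover have "ascent_count (turns w) n k \<le> ascent_count (turns l) n k" for k
    using ladder_turns[OF assms(4)] by (intro ascent_count_mono) blast
  ultimately show ?thesis using assms(2) by (simp add: coeff_snake_h_star)
qed

end
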